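(* For all $\beta \ge 0.53$, $$\inf_{n \ge 1,\ A \subset \{0,1\}^n,\ \mu(A) = 1/2} \mathbb{E}\, w_A^{\beta} = 1.$$ Moreover, for all $0.5 \le \beta < 0.53$, $$1 \;\ge\; \inf_{n \ge 1,\ A \subset \{0,1\}^n,\ \mu(A) = 1/2} \mathbb{E}\, w_A^{\beta} \;\ge\; \sqrt{2^{\beta+1}-2}.$$
   Context: The hypercube $\{0,1\}^n$ is regarded as a graph in which two vertices are adjacent iff they differ in exactly one coordinate. $\mu$ is the uniform probability measure on $\{0,1\}^n$ and $\mathbb{E}$ is expectation with respect to $\mu$. For $A \subset \{0,1\}^n$, $h_A:\{0,1\}^n \to \mathbb{R}$ is defined by $h_A(x)=0$ if $x \notin A$, and, if $x \in A$, $h_A(x)$ is the number of neighbours of $x$ lying in $A^c = \{0,1\}^n\setminus A$. The two-sided boundary function is $w_A(x) = h_A(x)$ if $x \in A$ and $w_A(x) = h_{A^c}(x)$ if $x \in A^c$. The infimum is over all integers $n \ge 1$ and all $A \subset \{0,1\}^n$ with $\mu(A)=1/2$. *)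

theory Defs
  imports "HOL-Analysis.Analysis"
begin

text \<open>The points of \<open>{0,1}\<^sup>n\<close> are the functions from \<open>{..<n}\<close> to \<open>{0,1}\<close>, extensional
  (i.e. \<open>undefined\<close> outside \<open>{..<n}\<close>), so that the cube has exactly \<open>2 ^ n\<close> elements.\<close>

definition cube :: "nat \<Rightarrow> (nat \<Rightarrow> nat) set" where
  "cube n = {..<n} \<rightarrow>\<^sub>E {0, 1}"

definition cube_adj :: "nat \<Rightarrow> (nat \<Rightarrow> nat) \<Rightarrow> (nat \<Rightarrow> nat) \<Rightarrow> bool" where
  "cube_adj n x y \<longleftrightarrow> x \<in> cube n \<and> y \<in> cube n \<and> (\<exists>!i. i < n \<and> x i \<noteq> y i)"

definition \<mu> :: "nat \<Rightarrow> (nat \<Rightarrow> nat) measure" where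
  "\<mu> n = uniform_count_measure (cube n)"

definition h :: "nat \<Rightarrow> (nat \<Rightarrow> nat) set \<Rightarrow> (nat \<Rightarrow> nat) \<Rightarrow> real" where
  "h n A x = (if x \<in> A then real (card {y \<in> cube n - A. cube_adj n x y}) else 0)"

definition w :: "nat \<Rightarrow> (nat \<Rightarrow> nat) set \<Rightarrow> (nat \<Rightarrow> nat) \<Rightarrow> real" where
  "w n A x = (if x \<in> A then h n A x else h n (cube n - A) x)"

text \<open>The infimum is taken in \<open>real\<close>, where \<open>Inf\<close> is meaningful only for nonempty sets that are
  bounded below. Here the set is nonempty (take \<open>n = 1\<close> and \<open>A\<close> a single point) and bounded below
  by \<open>0\<close>. At points with \<open>w n A x = 0\<close> the power is \<open>0 powr \<beta> = 0\<close>, which is the usual value for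
  the exponents \<open>\<beta> > 0\<close> of interest.\<close>

definition inf_boundary :: "real \<Rightarrow> real" where
  "inf_boundary \<beta> =
     Inf {(LINT x|\<mu> n. w n A x powr \<beta>) | n A.
            n \<ge> 1 \<and> A \<subseteq> cube n \<and> measure (\<mu> n) A = 1 / 2}"

end

theory Submission
  imports Defs
begin

text \<open>
  We bound \<open>\<bbbE> h\<^sub>A\<^sup>\<beta>\<close> from below by \<open>F (\<mu> A)\<close> with the cubic
  \<open>F y = l y (1 - y) (5 + 2 y) / 3\<close>, which vanishes at \<open>0\<close> and \<open>1\<close> and equals \<open>l / 2\<close> at \<open>1 / 2\<close>;
  adding the bounds for \<open>A\<close> and its complement gives \<open>\<bbbE> w\<^sub>A\<^sup>\<beta> \<ge> l\<close>. The bound is proved by induction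
  on \<open>n\<close>, splitting \<open>A\<close> into two slices along the last coordinate. If the slices have measures
  \<open>x \<le> y\<close>, then on a subset of the larger slice of measure at least \<open>u = y - x\<close> the boundary count
  increases by one. Applying a linear bound \<open>(k + 1)\<^sup>\<beta> \<ge> a + b k\<^sup>\<beta>\<close>, valid for all natural \<open>k\<close>,
  at those points reduces the induction step to
  \<open>2 F ((x + y) / 2) \<le> F x + b F y + a u\<close>, where \<open>a\<close> and \<open>b\<close> may depend on \<open>x\<close> and \<open>y\<close>. For the
  cubic, \<open>2 F ((x + y) / 2) - F x - F y = l (1 + x + y) u\<^sup>2 / 2\<close> exactly. The linear bounds are
  tangents of the convex minorant \<open>c (1 + \<delta>) / (t + \<delta>)\<close> of the increment
  \<open>(k + 1)\<^sup>\<beta> - k\<^sup>\<beta>\<close> as a function of \<open>t = k\<^sup>\<beta> \<ge> 1\<close>, together with the chord \<open>a = 1\<close>, \<open>b = c\<close>.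

  Since \<open>w\<close> takes natural values, \<open>\<bbbE> w\<^sub>A\<^sup>\<beta>\<close> is nondecreasing in \<open>\<beta>\<close>. Hence the exponent \<open>0.53\<close>
  with \<open>l = 1\<close>, and the exponent \<open>1 / 2\<close> with \<open>l = 0.944 \<ge> sqrt (2\<^bsup>1.53\<^esup> - 2)\<close>, suffice.
\<close>

subsection \<open>Induction on the dimension of the cube\<close>

definition flip :: "nat \<Rightarrow> (nat \<Rightarrow> nat) \<Rightarrow> nat \<Rightarrow> nat" where
  "flip j x = x(j := 1 - x j)"

text \<open>Points of \<open>cube n\<close> are undefined at coordinate \<open>n\<close>, so a slice
  is again a subset of \<open>cube n\<close> and falls under the induction hypothesis.\<close>

definition slice :: "nat \<Rightarrow> nat \<Rightarrow> (nat \<Rightarrow> nat) set \<Rightarrow> (nat \<Rightarrow> nat) set" where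
  "slice n i A = {x \<in> cube n. x(n := i) \<in> A}"

text \<open>For \<open>A\<close> in the cube this is \<open>2 ^ n\<close> times the mean of
  \<open>h n A x powr \<beta>\<close>: outside \<open>A\<close> the integrand is
  \<open>0 powr \<beta> = 0\<close>.\<close>

definition boundary_sum :: "real \<Rightarrow> nat \<Rightarrow> (nat \<Rightarrow> nat) set \<Rightarrow> real" where
  "boundary_sum \<beta> n A = (\<Sum>x\<in>A. h n A x powr \<beta>)"

lemma finite_cube [simp]: "finite (cube n)"
  by (auto simp: cube_def intro: finite_PiE)

lemma card_cube [simp]: "card (cube n) = 2 ^ n"
  by (simp add: cube_def card_PiE numeral_2_eq_2)

lemma cube_valD: "x \<in> cube n \<Longrightarrow> j < n \<Longrightarrow> x j = 0 \<or> x j = 1"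
  by (auto simp: cube_def PiE_def Pi_def)

lemma flip_in_cube: "x \<in> cube n \<Longrightarrow> j < n \<Longrightarrow> flip j x \<in> cube n"
  by (auto simp: cube_def flip_def PiE_def Pi_def extensional_def)

lemma cube_adj_iff_flip:
  assumes "x \<in> cube n"
  shows "cube_adj n x y \<longleftrightarrow> (\<exists>j<n. y = flip j x)"
proof
  assume "cube_adj n x y"
  then have y: "y \<in> cube n" and ex1: "\<exists>!i. i < n \<and> x i \<noteq> y i"
    by (simp_all only: cube_adj_def)
  from ex1 obtain j where j': "j < n \<and> x j \<noteq> y j"
    and uniq: "\<forall>i. i < n \<and> x i \<noteq> y i \<longrightarrow> i = j"
    by (rule ex1E)
  from j' have j: "j < n" "x j \<noteq> y j" by simp_all
  have flipped: "y j = 1 - x j"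
    using cube_valD[OF assms j(1)] cube_valD[OF y j(1)] j(2) by (elim disjE) simp_all
  have "y i = flip j x i" for i
  proof -
    consider "i = j" | "i < n" "i \<noteq> j" | "\<not> i < n" by blast
    then show ?thesis
    proof cases
      case 1
      then show ?thesis using flipped by (simp add: flip_def)
    next
      case 2
      then have "x i = y i" using uniq by blast
      then show ?thesis using 2 by (simp add: flip_def)
    next
      case 3
      then have "x i = undefined" "y i = undefined"
        using PiE_arb[of x "{..<n}" "\<lambda>_. {0, 1}" i] PiE_arb[of y "{..<n}" "\<lambda>_. {0, 1}" i] assms y
        by (simp_all add: cube_def)
      then show ?thesis using 3 j(1) by (auto simp: flip_def)
    qed
  qed
  then have "y = flip j x" by (rule ext)
  with j(1) show "\<exists>j<n. y = flip j x" by blast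
next
  assume "\<exists>j<n. y = flip j x"
  then obtain j where j: "j < n" "y = flip j x" by blast
  have "x j \<noteq> 1 - x j" using cube_valD[OF assms j(1)] by (elim disjE) simp_all
  then have "\<exists>!i. i < n \<and> x i \<noteq> y i"
    unfolding j(2) flip_def using j(1) by (intro ex1I[of _ j]) (simp_all split: if_splits)
  then show "cube_adj n x y"
    unfolding cube_adj_def using assms flip_in_cube[OF assms j(1)] j(2) by simp
qed

text \<open>Counting directions instead of neighbours lets the count be split by coordinate;
  distinct directions give distinct neighbours.\<close>

lemma h_eq_card_flip:
  assumes "A \<subseteq> cube n" "x \<in> A"
  shows "h n A x = real (card {j. j < n \<and> flip j x \<notin> A})"
proof -
  have x: "x \<in> cube n" using assms by blast
  have "{y \<in> cube n - A. cube_adj n x y} = (\<lambda>j. flip j x) ` {j. j < n \<and> flip j x \<notin> A}"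
    using flip_in_cube[OF x] by (auto simp: cube_adj_iff_flip[OF x])
  moreover have "inj_on (\<lambda>j. flip j x) {j. j < n \<and> flip j x \<notin> A}"
  proof (rule inj_onI)
    fix i j assume *: "i \<in> {j. j < n \<and> flip j x \<notin> A}" "flip i x = flip j x"
    from * have eq: "flip i x i = flip j x i" by metis
    show "i = j"
    proof (rule ccontr)
      assume "i \<noteq> j"
      then have "1 - x i = x i" using eq by (simp add: flip_def)
      then show False using cube_valD[OF x, of i] * by auto
    qed
  qed
  ultimately show ?thesis using assms by (simp add: h_def card_image)
qed

lemma inj_on_upd_cube: "inj_on (\<lambda>x. x(n := i)) (cube n)"
proof (rule inj_onI)
  fix x y assume *: "x \<in> cube n" "y \<in> cube n" "x(n := i) = y(n := i)"
  have "x k = y k" for k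
    using fun_cong[OF *(3), of k] *(1,2)
    by (cases "k = n") (auto simp: cube_def PiE_def extensional_def)
  then show "x = y" by (rule ext)
qed

lemma slice_subset: "slice n i A \<subseteq> cube n"
  by (auto simp: slice_def)

lemma finite_slice [simp]: "finite (slice n i A)"
  by (rule finite_subset[OF slice_subset]) simp

lemma cube_Suc_decomp:
  assumes "A \<subseteq> cube (Suc n)"
  shows "A = (\<lambda>x. x(n := 0)) ` slice n 0 A \<union> (\<lambda>x. x(n := 1)) ` slice n 1 A"
proof
  show "A \<subseteq> (\<lambda>x. x(n := 0)) ` slice n 0 A \<union> (\<lambda>x. x(n := 1)) ` slice n 1 A"
  proof
    fix x assume "x \<in> A"
    then have "x \<in> {..<Suc n} \<rightarrow>\<^sub>E {0, 1}" using assms unfolding cube_def by blast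
    then obtain y i where y: "i \<in> {0, 1}" "y \<in> cube n" "x = y(n := i)"
      by (auto simp: lessThan_Suc PiE_insert_eq cube_def)
    with \<open>x \<in> A\<close> have "y \<in> slice n i A" by (simp add: slice_def)
    with y show "x \<in> (\<lambda>x. x(n := 0)) ` slice n 0 A \<union> (\<lambda>x. x(n := 1)) ` slice n 1 A"
      by auto
  qed
qed (auto simp: slice_def)

lemma sum_cube_Suc:
  fixes f :: "(nat \<Rightarrow> nat) \<Rightarrow> 'a::comm_monoid_add"
  assumes "A \<subseteq> cube (Suc n)"
  shows "sum f A = (\<Sum>x\<in>slice n 0 A. f (x(n := 0))) + (\<Sum>x\<in>slice n 1 A. f (x(n := 1)))"
proof -
  have "(\<lambda>x. x(n := 0)) ` slice n 0 A \<inter> (\<lambda>x. x(n := 1)) ` slice n 1 A = {}"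
    by (auto dest: fun_cong[where x = n])
  moreover have "inj_on (\<lambda>x. x(n := i)) (slice n i A)" for i
    by (rule inj_on_subset[OF inj_on_upd_cube slice_subset])
  ultimately show ?thesis
    by (subst cube_Suc_decomp[OF assms]) (simp add: sum.union_disjoint sum.reindex)
qed

lemma card_slice:
  assumes "A \<subseteq> cube (Suc n)"
  shows "card A = card (slice n 0 A) + card (slice n 1 A)"
  using sum_cube_Suc[OF assms, of "\<lambda>_. 1 :: nat"] by simp

text \<open>Directions below \<open>n\<close> stay inside the slice, while direction
  \<open>n\<close> leads to the same point of the other slice.\<close>

lemma h_slice:
  assumes "A \<subseteq> cube (Suc n)" "x \<in> slice n i A" "i \<in> {0, 1}"
  shows "h (Suc n) A (x(n := i)) = h n (slice n i A) x + of_bool (x \<notin> slice n (1 - i) A)"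
proof -
  have x: "x \<in> cube n" "x(n := i) \<in> A" using assms by (auto simp: slice_def)
  have low: "flip j (x(n := i)) \<in> A \<longleftrightarrow> flip j x \<in> slice n i A" if "j < n" for j
    using that flip_in_cube[OF x(1) that] by (simp add: slice_def flip_def fun_upd_twist)
  have top: "flip n (x(n := i)) \<in> A \<longleftrightarrow> x \<in> slice n (1 - i) A"
    using x by (simp add: slice_def flip_def)
  have "{j. j < Suc n \<and> flip j (x(n := i)) \<notin> A} =
      {j. j < n \<and> flip j x \<notin> slice n i A} \<union> (if x \<in> slice n (1 - i) A then {} else {n})"
    using low top by (auto simp: less_Suc_eq)
  then have "card {j. j < Suc n \<and> flip j (x(n := i)) \<notin> A} =
      card {j. j < n \<and> flip j x \<notin> slice n i A} + of_bool (x \<notin> slice n (1 - i) A)"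
    by simp
  then show ?thesis
    using h_eq_card_flip[OF assms(1) x(2)] h_eq_card_flip[OF slice_subset assms(2)] by simp
qed

lemma h_nat: "h n A x \<in> \<nat>"
  by (simp add: h_def)

lemma h_nonneg: "0 \<le> h n A x"
  by (simp add: h_def)

text \<open>The possible gain on \<open>P\<close> is thrown away. On \<open>Q\<close> the old
  integrand is scaled by \<open>c\<close>, and \<open>a\<close> is collected on
  \<open>Q - P\<close>, which has at least \<open>card Q - card P\<close> points.\<close>

lemma two_slice_bound:
  fixes F :: "real \<Rightarrow> real"
  assumes F: "\<And>x y. 0 \<le> x \<Longrightarrow> x \<le> y \<Longrightarrow> y \<le> 1 \<Longrightarrow> \<exists>a c. 0 \<le> a \<and> 0 \<le> c \<and> c \<le> 1 \<and>
      (\<forall>k::nat. a + c * real k powr \<beta> \<le> real (k + 1) powr \<beta>) \<and>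
      2 * F ((x + y) / 2) \<le> F x + c * F y + a * (y - x)"
    and P: "P \<subseteq> cube n" "2 ^ n * F (card P / 2 ^ n) \<le> boundary_sum \<beta> n P"
    and Q: "Q \<subseteq> cube n" "2 ^ n * F (card Q / 2 ^ n) \<le> boundary_sum \<beta> n Q"
    and le: "card P \<le> card Q" and \<beta>: "0 \<le> \<beta>"
  shows "2 ^ Suc n * F ((card P + card Q) / 2 ^ Suc n) \<le>
    (\<Sum>x\<in>P. (h n P x + of_bool (x \<notin> Q)) powr \<beta>) + (\<Sum>x\<in>Q. (h n Q x + of_bool (x \<notin> P)) powr \<beta>)"
proof -
  have fin: "finite P" "finite Q" using P Q finite_subset[OF _ finite_cube] by blast+
  have "card Q \<le> card (cube n)" using Q(1) by (intro card_mono) auto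
  then have "real (card Q) \<le> 2 ^ n" by (metis card_cube of_nat_le_iff of_nat_numeral of_nat_power)
  then obtain a c where ac: "0 \<le> a" "0 \<le> c" "c \<le> 1"
      "\<And>k::nat. a + c * real k powr \<beta> \<le> real (k + 1) powr \<beta>"
    and mid: "2 * F ((card P / 2 ^ n + card Q / 2 ^ n) / 2) \<le>
        F (card P / 2 ^ n) + c * F (card Q / 2 ^ n) + a * (card Q / 2 ^ n - card P / 2 ^ n)"
    using F[of "card P / 2 ^ n" "card Q / 2 ^ n"] le by (simp add: divide_right_mono) blast
  have avg: "(card P + card Q) / 2 ^ Suc n = (card P / 2 ^ n + card Q / 2 ^ n) / (2 :: real)"
    by (simp add: field_simps)
  have "2 ^ Suc n * F ((card P + card Q) / 2 ^ Suc n) =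
      2 ^ n * (2 * F ((card P / 2 ^ n + card Q / 2 ^ n) / 2))"
    unfolding avg by simp
  also have "\<dots> \<le> 2 ^ n * (F (card P / 2 ^ n) + c * F (card Q / 2 ^ n) +
      a * (card Q / 2 ^ n - card P / 2 ^ n))"
    using mid by (intro mult_left_mono) auto
  also have "\<dots> = 2 ^ n * F (card P / 2 ^ n) + c * (2 ^ n * F (card Q / 2 ^ n)) +
      a * (real (card Q) - real (card P))"
    by (simp add: algebra_simps)
  also have "\<dots> \<le> boundary_sum \<beta> n P + c * boundary_sum \<beta> n Q + a * real (card (Q - P))"
  proof (intro add_mono mult_left_mono)
    have "card Q \<le> card P + card (Q - P)"
      by (metis Un_Diff_cancel card_Un_le card_mono fin finite_UnI sup_ge2 le_trans)
    then show "real (card Q) - real (card P) \<le> real (card (Q - P))" by linarith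
  qed (use P Q ac in auto)
  also have "\<dots> = boundary_sum \<beta> n P + (\<Sum>x\<in>Q. c * h n Q x powr \<beta> + a * of_bool (x \<notin> P))"
  proof -
    have "(\<Sum>x\<in>Q. of_bool (x \<notin> P)) = real (card (Q - P))"
      using fin by (simp add: of_bool_def sum.If_cases Diff_eq Compl_eq)
    then show ?thesis
      by (simp add: boundary_sum_def sum.distrib flip: sum_distrib_left)
  qed
  also have "\<dots> \<le> (\<Sum>x\<in>P. (h n P x + of_bool (x \<notin> Q)) powr \<beta>) +
      (\<Sum>x\<in>Q. (h n Q x + of_bool (x \<notin> P)) powr \<beta>)"
  proof (rule add_mono)
    show "boundary_sum \<beta> n P \<le> (\<Sum>x\<in>P. (h n P x + of_bool (x \<notin> Q)) powr \<beta>)"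
      unfolding boundary_sum_def by (intro sum_mono powr_mono2 \<beta> h_nonneg) simp
    show "(\<Sum>x\<in>Q. c * h n Q x powr \<beta> + a * of_bool (x \<notin> P)) \<le>
        (\<Sum>x\<in>Q. (h n Q x + of_bool (x \<notin> P)) powr \<beta>)"
    proof (rule sum_mono)
      fix x
      obtain k :: nat where k: "h n Q x = real k"
        using h_nat[of n Q x] by (auto elim: Nats_cases)
      \<comment> \<open>On the common part of \<open>Q\<close> and \<open>P\<close> the count is
        unchanged, and \<open>c \<le> 1\<close> suffices.\<close>
      have "c * real k powr \<beta> \<le> real k powr \<beta>" using ac by (simp add: mult_left_le_one_le)
      then show "c * h n Q x powr \<beta> + a * of_bool (x \<notin> P) \<le>
          (h n Q x + of_bool (x \<notin> P)) powr \<beta>"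
        using ac(4)[of k] by (auto simp: k add_ac)
    qed
  qed
  finally show ?thesis .
qed

theorem boundary_sum_ge:
  fixes F :: "real \<Rightarrow> real"
  assumes F: "\<And>x y. 0 \<le> x \<Longrightarrow> x \<le> y \<Longrightarrow> y \<le> 1 \<Longrightarrow> \<exists>a c. 0 \<le> a \<and> 0 \<le> c \<and> c \<le> 1 \<and>
      (\<forall>k::nat. a + c * real k powr \<beta> \<le> real (k + 1) powr \<beta>) \<and>
      2 * F ((x + y) / 2) \<le> F x + c * F y + a * (y - x)"
    and F01: "F 0 = 0" "F 1 = 0" and \<beta>: "0 \<le> \<beta>"
  shows "A \<subseteq> cube n \<Longrightarrow> 2 ^ n * F (card A / 2 ^ n) \<le> boundary_sum \<beta> n A"
proof (induction n arbitrary: A)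
  case 0
  \<comment> \<open>\<open>cube 0\<close> is a single point, so the measure of \<open>A\<close> is 0
    or 1, the zeros of \<open>F\<close>.\<close>
  then have "card A \<le> card (cube 0)" by (intro card_mono) auto
  then have "card A = 0 \<or> card A = 1" unfolding card_cube by auto
  then have "F (card A) = 0" using F01 by auto
  then show ?case by (simp add: boundary_sum_def sum_nonneg)
next
  case (Suc n)
  let ?P = "slice n 0 A" and ?Q = "slice n 1 A"
  have "boundary_sum \<beta> (Suc n) A = (\<Sum>x\<in>?P. (h n ?P x + of_bool (x \<notin> ?Q)) powr \<beta>) +
      (\<Sum>x\<in>?Q. (h n ?Q x + of_bool (x \<notin> ?P)) powr \<beta>)"
    unfolding boundary_sum_def sum_cube_Suc[OF Suc.prems]
    using h_slice[OF Suc.prems, of _ 0] h_slice[OF Suc.prems, of _ 1]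
    by (intro arg_cong2[where f = "(+)"] sum.cong) auto
  moreover have "2 ^ Suc n * F ((card ?P + card ?Q) / 2 ^ Suc n) \<le>
      (\<Sum>x\<in>?P. (h n ?P x + of_bool (x \<notin> ?Q)) powr \<beta>) +
      (\<Sum>x\<in>?Q. (h n ?Q x + of_bool (x \<notin> ?P)) powr \<beta>)"
  proof (cases "card ?P \<le> card ?Q")
    case True
    then show ?thesis
      by (intro two_slice_bound[OF F] Suc.IH slice_subset \<beta>) auto
  next
    case False
    then have "2 ^ Suc n * F ((card ?Q + card ?P) / 2 ^ Suc n) \<le>
      (\<Sum>x\<in>?Q. (h n ?Q x + of_bool (x \<notin> ?P)) powr \<beta>) +
      (\<Sum>x\<in>?P. (h n ?P x + of_bool (x \<notin> ?Q)) powr \<beta>)"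
      by (intro two_slice_bound[OF F] Suc.IH slice_subset \<beta>) auto
    then show ?thesis by (simp add: add.commute)
  qed
  ultimately show ?case by (simp add: card_slice[OF Suc.prems])
qed

section \<open>The mean of the two-sided boundary function and its infimum\<close>

definition mean_w :: "real \<Rightarrow> nat \<Rightarrow> (nat \<Rightarrow> nat) set \<Rightarrow> real" where
  "mean_w \<beta> n A = (LINT x|\<mu> n. w n A x powr \<beta>)"

lemma mean_w_eq:
  assumes "A \<subseteq> cube n"
  shows "mean_w \<beta> n A = (boundary_sum \<beta> n A + boundary_sum \<beta> n (cube n - A)) / 2 ^ n"
proof -
  have "(\<Sum>x\<in>cube n. w n A x powr \<beta>) =
      (\<Sum>x\<in>A. w n A x powr \<beta>) + (\<Sum>x\<in>cube n - A. w n A x powr \<beta>)"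
    using assms by (subst sum.subset_diff[OF assms]) (auto simp: add.commute)
  also have "\<dots> = boundary_sum \<beta> n A + boundary_sum \<beta> n (cube n - A)"
    unfolding boundary_sum_def by (intro arg_cong2[where f = "(+)"] sum.cong) (auto simp: w_def)
  finally show ?thesis
    by (simp add: mean_w_def \<mu>_def integral_uniform_count_measure)
qed

lemma mean_w_ge:
  fixes F :: "real \<Rightarrow> real"
  assumes F: "\<And>x y. 0 \<le> x \<Longrightarrow> x \<le> y \<Longrightarrow> y \<le> 1 \<Longrightarrow> \<exists>a c. 0 \<le> a \<and> 0 \<le> c \<and> c \<le> 1 \<and>
      (\<forall>k::nat. a + c * real k powr \<beta> \<le> real (k + 1) powr \<beta>) \<and>
      2 * F ((x + y) / 2) \<le> F x + c * F y + a * (y - x)"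
    and F01: "F 0 = 0" "F 1 = 0" and \<beta>: "0 \<le> \<beta>"
    and A: "A \<subseteq> cube n" "measure (\<mu> n) A = 1 / 2"
  shows "2 * F (1 / 2) \<le> mean_w \<beta> n A"
proof -
  have "measure (\<mu> n) A = card A / 2 ^ n"
    using A(1) by (simp add: \<mu>_def measure_uniform_count_measure)
  then have half: "card A / 2 ^ n = (1 / 2 :: real)" using A(2) by metis
  have "card (cube n - A) = card (cube n) - card A"
    using A finite_subset[OF A(1)] by (simp add: card_Diff_subset)
  moreover have "card A \<le> card (cube n)" using A by (intro card_mono) auto
  ultimately have "real (card (cube n - A)) = 2 ^ n - real (card A)" by (simp add: of_nat_diff)
  then have "card (cube n - A) / 2 ^ n = 1 - card A / (2 ^ n :: real)"
    by (simp add: diff_divide_distrib)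
  also have "\<dots> = 1 - 1 / 2" unfolding half ..
  also have "\<dots> = 1 / 2" by simp
  finally have half': "card (cube n - A) / 2 ^ n = (1 / 2 :: real)" .
  have "2 ^ n * F (1 / 2) + 2 ^ n * F (1 / 2) \<le>
      boundary_sum \<beta> n A + boundary_sum \<beta> n (cube n - A)"
    using boundary_sum_ge[OF F F01 \<beta> A(1)] boundary_sum_ge[OF F F01 \<beta>, of "cube n - A" n]
    unfolding half half' by auto
  then show ?thesis
    unfolding mean_w_eq[OF A(1)] by (simp add: field_simps)
qed

lemma mean_w_mono:
  assumes "A \<subseteq> cube n" "\<beta> \<le> \<beta>'"
  shows "mean_w \<beta> n A \<le> mean_w \<beta>' n A"
proof -
  have "h n B x powr \<beta> \<le> h n B x powr \<beta>'" for B x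
  proof -
    obtain k :: nat where "h n B x = real k" using h_nat[of n B x] by (auto elim: Nats_cases)
    \<comment> \<open>Monotonicity in the exponent needs a base of at least 1; at
      \<open>k = 0\<close> both powers are 0.\<close>
    then show ?thesis using assms(2) by (cases "k = 0") (auto intro: powr_mono)
  qed
  then show ?thesis
    unfolding mean_w_eq[OF assms(1)] boundary_sum_def
    by (intro divide_right_mono add_mono sum_mono) auto
qed

text \<open>The value 1 is attained by a single point in dimension one, where each of the two points
  has one neighbour across the boundary. The bound \<open>b\<close> also supplies the lower
  boundedness that the real \<open>Inf\<close> needs.\<close>

lemma inf_boundary_ge:
  assumes b: "\<And>n A. A \<subseteq> cube n \<Longrightarrow> measure (\<mu> n) A = 1 / 2 \<Longrightarrow> b \<le> mean_w \<beta> n A"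
  shows "b \<le> inf_boundary \<beta>" "inf_boundary \<beta> \<le> 1"
proof -
  define A :: "(nat \<Rightarrow> nat) set" where "A = {x \<in> cube 1. x 0 = 0}"
  have c1: "cube 1 = {(\<lambda>_. undefined)(0 := 0), (\<lambda>_. undefined)(0 := 1)}"
    by (auto simp: cube_def PiE_insert_eq lessThan_Suc)
  have sub: "A \<subseteq> cube 1" by (auto simp: A_def)
  have A1: "A = {(\<lambda>_. undefined)(0 := 0)}" unfolding A_def c1 by auto
  have B1: "cube 1 - A = {(\<lambda>_. undefined)(0 := 1)}"
    unfolding A_def c1 by (auto dest: fun_cong[where x = 0])
  have half: "measure (\<mu> 1) A = 1 / 2"
    using sub by (simp add: \<mu>_def measure_uniform_count_measure) (simp add: A1)
  have "{j. j < 1 \<and> flip j x \<notin> A} = {0}" if "x \<in> A" for x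
    using that by (auto simp: A_def flip_def)
  then have "h 1 A x = 1" if "x \<in> A" for x using that h_eq_card_flip[OF sub that] by simp
  then have SA: "boundary_sum \<beta> 1 A = 1" by (simp add: boundary_sum_def A1)
  have "{j. j < 1 \<and> flip j x \<notin> cube 1 - A} = {0}" if "x \<in> cube 1 - A" for x
    using that flip_in_cube[of x 1 0] cube_valD[of x 1 0] by (auto simp: A_def flip_def)
  then have "h 1 (cube 1 - A) x = 1" if "x \<in> cube 1 - A" for x
    using that h_eq_card_flip[OF _ that] by simp
  then have "boundary_sum \<beta> 1 (cube 1 - A) = (\<Sum>x\<in>cube 1 - A. 1)"
    unfolding boundary_sum_def by (intro sum.cong) auto
  then have SB: "boundary_sum \<beta> 1 (cube 1 - A) = 1" unfolding B1 by simp
  have 1: "mean_w \<beta> 1 A = 1" unfolding mean_w_eq[OF sub] SA SB by simp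
  let ?S = "{mean_w \<beta> n A | n A. n \<ge> 1 \<and> A \<subseteq> cube n \<and> measure (\<mu> n) A = 1 / 2}"
  have inf: "inf_boundary \<beta> = Inf ?S" by (simp add: inf_boundary_def mean_w_def)
  have "1 = mean_w \<beta> 1 A \<and> (1 :: nat) \<le> 1 \<and> A \<subseteq> cube 1 \<and> measure (\<mu> 1) A = 1 / 2"
    using 1[symmetric] sub half by (intro conjI) (assumption | rule order_refl)+
  then have mem: "1 \<in> ?S" by blast
  show "b \<le> inf_boundary \<beta>" unfolding inf using mem b by (intro cInf_greatest) auto
  have "bdd_below ?S" using b by (intro bdd_belowI[of _ b]) auto
  then show "inf_boundary \<beta> \<le> 1" unfolding inf using mem by (intro cInf_lower)
qed

subsection \<open>The two-point inequality for the cubic\<close>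

definition cubic :: "real \<Rightarrow> real" where
  "cubic y = y * (1 - y) * (5 + 2 * y) / 3"

lemma cubic_nonneg: "0 \<le> y \<Longrightarrow> y \<le> 1 \<Longrightarrow> 0 \<le> cubic y"
  by (simp add: cubic_def)

text \<open>For a cubic the second-order Taylor formula at the midpoint is exact for symmetric sums;
  here the second derivative is \<open>- (2 + 4 * y)\<close>.\<close>

lemma cubic_midpoint:
  "2 * cubic ((x + y) / 2) = cubic x + cubic y + (1 + x + y) * (y - x)\<^sup>2 / 2"
  by (simp add: cubic_def field_simps power2_eq_square power3_eq_cube)

lemma tangent_reciprocal_le:
  fixes s t :: real
  assumes "0 < s" "0 < t"
  shows "(2 * s - t) / s\<^sup>2 \<le> 1 / t"
proof -
  have "t * (2 * s - t) \<le> s\<^sup>2"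
    using zero_le_power2[of "s - t"] by (simp add: power2_eq_square algebra_simps)
  then show ?thesis using assms by (simp add: field_simps)
qed

text \<open>With \<open>f = l * cubic y\<close>, the quantity to maximise is
  \<open>a * u + b * f = u * (a + b * (f / u))\<close>, so the linear bound should be sharp at
  \<open>f / u\<close>. If \<open>f / u\<close> is at least 1, the least positive value of
  \<open>k powr \<beta>\<close>, a tangent of the minorant is used; otherwise the chord over
  \<open>[0, 1]\<close>.\<close>

lemma bellman_two_point:
  fixes c \<delta> l \<beta> :: real
  assumes l: "0 < l" "l \<le> 1" and \<delta>: "0 \<le> \<delta>" and c: "2 / 5 \<le> c" "c \<le> 1 / 2" and \<beta>: "0 \<le> \<beta>"
    and key: "\<And>u y. 0 \<le> u \<Longrightarrow> u \<le> y \<Longrightarrow> y \<le> 1 \<Longrightarrow> u \<le> l * cubic y \<Longrightarrow>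
      l * (1 + 2 * y - u) * (l * cubic y + \<delta> * u) \<le> 2 * c * (1 + \<delta>)"
    and incr: "\<And>k::nat. 1 \<le> k \<Longrightarrow>
      real k powr \<beta> + c * (1 + \<delta>) / (real k powr \<beta> + \<delta>) \<le> real (k + 1) powr \<beta>"
    and xy: "0 \<le> x" "x \<le> y" "y \<le> 1"
  shows "\<exists>a b. 0 \<le> a \<and> 0 \<le> b \<and> b \<le> 1 \<and>
      (\<forall>k::nat. a + b * real k powr \<beta> \<le> real (k + 1) powr \<beta>) \<and>
      2 * (l * cubic ((x + y) / 2)) \<le> l * cubic x + b * (l * cubic y) + a * (y - x)"
proof -
  define u f \<gamma> where "u = y - x" and "f = l * cubic y" and "\<gamma> = c * (1 + \<delta>)"
  have u: "0 \<le> u" "u \<le> y" using xy by (auto simp: u_def)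
  have f: "0 \<le> f" using cubic_nonneg[of y] xy l by (simp add: f_def)
  have \<gamma>: "0 \<le> \<gamma>" "\<gamma> \<le> (1 + \<delta>) / 2"
    using c \<delta> mult_right_mono[of c "1 / 2" "1 + \<delta>"] by (auto simp: \<gamma>_def)
  have x_eq: "1 + x + y = 1 + 2 * y - u" by (simp add: u_def)
  have "2 * (l * cubic ((x + y) / 2)) = l * (2 * cubic ((x + y) / 2))" by simp
  also have "\<dots> = l * cubic x + f + l * (1 + 2 * y - u) * u\<^sup>2 / 2"
    unfolding cubic_midpoint by (simp add: f_def u_def algebra_simps)
  finally have mid: "2 * (l * cubic ((x + y) / 2)) = l * cubic x + f + l * (1 + 2 * y - u) * u\<^sup>2 / 2" .
  have t1: "1 \<le> real k powr \<beta>" if "1 \<le> k" for k :: nat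
    using that \<beta> by (simp add: ge_one_powr_ge_zero)
  consider "u = 0" | "0 < u" "u \<le> f" | "f < u" using u by linarith
  then show ?thesis
  proof cases
    case 1
    have "real k powr \<beta> \<le> real (k + 1) powr \<beta>" for k :: nat
      using \<beta> by (intro powr_mono2) auto
    with mid 1 show ?thesis
      by (intro exI[of _ 0] exI[of _ 1]) (auto simp: f_def u_def)
  next
    case 2
    define \<tau> S where "\<tau> = f / u" and "S = \<tau> + \<delta>"
    have \<tau>: "1 \<le> \<tau>" using 2 by (simp add: \<tau>_def)
    then have S: "1 + \<delta> \<le> S" "0 < S" "\<tau> \<le> S" using \<delta> by (auto simp: S_def)
    have "\<gamma> \<le> (1 + \<delta>) / 2" by (fact \<gamma>)
    also have "\<dots> \<le> S / 2" using S by simp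
    finally have \<gamma>S: "\<gamma> \<le> S / 2" .
    have "\<gamma> * 1 \<le> S / 2 * S" using \<gamma> \<gamma>S S \<delta> by (intro mult_mono) auto
    then have \<gamma>SS: "\<gamma> / S\<^sup>2 \<le> 1" using \<gamma>(1) S by (simp add: power2_eq_square field_simps)
    \<comment> \<open>\<open>a + b * t\<close> is the tangent of
      \<open>t + \<gamma> / (t + \<delta>)\<close> at \<open>t = \<tau>\<close>; its value there
      exceeds \<open>\<tau>\<close> by \<open>\<gamma> / S\<close>.\<close>
    define a b where "a = \<gamma> * (\<tau> + S) / S\<^sup>2" and "b = 1 - \<gamma> / S\<^sup>2"
    have "a + b * real k powr \<beta> \<le> real (k + 1) powr \<beta>" for k :: nat
    proof (cases "k = 0")
      case True
      \<comment> \<open>\<open>incr\<close> starts at \<open>k = 1\<close>; at \<open>k = 0\<close>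
        the claim is \<open>a \<le> 1\<close>, since \<open>0 powr \<beta> = 0\<close>.\<close>
      have "\<gamma> * (\<tau> + S) \<le> S / 2 * (2 * S)"
        using \<gamma> \<gamma>S S \<tau> by (intro mult_mono) auto
      then have "a \<le> 1" using S by (simp add: a_def power2_eq_square)
      with True show ?thesis by simp
    next
      case False
      let ?t = "real k powr \<beta>"
      have "1 \<le> ?t" using t1 False by simp
      have "2 * S - (?t + \<delta>) = \<tau> + S - ?t" by (simp add: S_def)
      then have "a + b * ?t = ?t + \<gamma> * ((2 * S - (?t + \<delta>)) / S\<^sup>2)"
        by (simp add: a_def b_def algebra_simps add_divide_distrib diff_divide_distrib)
      also have "\<dots> \<le> ?t + \<gamma> * (1 / (?t + \<delta>))"
        using tangent_reciprocal_le[of S "?t + \<delta>"] S \<open>1 \<le> ?t\<close> \<delta> \<gamma>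
        by (intro add_left_mono mult_left_mono) auto
      also have "\<dots> \<le> real (k + 1) powr \<beta>" using incr[of k] False by (simp add: \<gamma>_def)
      finally show ?thesis .
    qed
    moreover have "l * (1 + 2 * y - u) * u\<^sup>2 / 2 \<le> a * u + b * f - f"
    proof -
      have fu: "f = \<tau> * u" using 2 by (simp add: \<tau>_def)
      \<comment> \<open>The claim is \<open>key\<close> multiplied by
        \<open>u / (2 * S)\<close>.\<close>
      have "l * (1 + 2 * y - u) * (f + \<delta> * u) \<le> 2 * \<gamma>"
        using key[of u y] u xy 2 by (simp add: f_def \<gamma>_def algebra_simps)
      also have "f + \<delta> * u = S * u" by (simp add: fu S_def algebra_simps)
      finally have "(l * (1 + 2 * y - u) * u / 2) * S \<le> \<gamma>" by (simp add: algebra_simps)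
      then have "l * (1 + 2 * y - u) * u / 2 \<le> \<gamma> / S" using S by (simp add: pos_le_divide_eq)
      then have "u * (l * (1 + 2 * y - u) * u / 2) \<le> u * (\<gamma> / S)"
        using u by (intro mult_left_mono)
      also have "u * (\<gamma> / S) = a * u + b * f - f"
        using S by (simp add: a_def b_def fu field_simps power2_eq_square)
      finally show ?thesis by (simp add: power2_eq_square mult_ac)
    qed
    moreover have "0 \<le> a" using \<gamma> \<tau> S by (simp add: a_def)
    moreover have "0 \<le> b" "b \<le> 1" using \<gamma> \<gamma>SS by (auto simp: b_def)
    ultimately show ?thesis
      unfolding mid f_def[symmetric] u_def[symmetric] by (intro exI[of _ a] exI[of _ b]) auto
  next
    case 3
    \<comment> \<open>The line passes through \<open>(0, 1)\<close> and \<open>(1, 1 + c)\<close>.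
      The second point lies on the minorant, whence the factor \<open>t - 1\<close> below.\<close>
    have "1 + c * real k powr \<beta> \<le> real (k + 1) powr \<beta>" for k :: nat
    proof (cases "k = 0")
      case False
      define t where "t = real k powr \<beta>"
      have t: "1 \<le> t" using t1 False by (simp add: t_def)
      have "0 \<le> (t - 1) * ((1 - c) * (t - 1) + (1 - 2 * c) + \<delta> * (1 - c))"
        using t c \<delta> by (intro mult_nonneg_nonneg add_nonneg_nonneg) auto
      also have "\<dots> = (t + \<delta>) * (t - 1 - c * t) + c * (1 + \<delta>)"
        by (simp add: algebra_simps)
      finally have "1 + c * t \<le> t + c * (1 + \<delta>) / (t + \<delta>)"
        using t \<delta> by (simp add: field_simps)
      with incr[of k] False show ?thesis by (simp add: t_def)
    qed simp
    moreover have "l * (1 + 2 * y - u) * u\<^sup>2 / 2 \<le> u - (1 - c) * f"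
    proof -
      \<comment> \<open>\<open>q\<close> is convex on \<open>{0..y}\<close>, so only the endpoints \<open>f\<close> and \<open>y\<close> of the range of \<open>u\<close> matter.\<close>
      define q where "q v = (1 + 2 * y - v) * v\<^sup>2" for v
      have fy: "f < y" using 3 u by simp
      \<comment> \<open>The last factor is the second divided difference of \<open>q\<close> at
        \<open>f\<close>, \<open>u\<close>, \<open>y\<close>, and equals
        \<open>(y - f) + (1 - u)\<close>.\<close>
      have "0 \<le> (y - f) * (y - u) * (u - f) * (1 + 2 * y - (f + u + y))"
        using fy 3 u xy by (intro mult_nonneg_nonneg) auto
      also have "\<dots> = (y - u) * q f + (u - f) * q y - (y - f) * q u"
        by (simp add: q_def power2_eq_square algebra_simps)
      finally have conv: "(y - f) * q u \<le> (y - u) * q f + (u - f) * q y" by simp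
      have qf: "l * q f \<le> 2 * c * f"
      proof -
        \<comment> \<open>At \<open>u = f\<close> the tangent and chord regimes meet, so
          \<open>key\<close> still applies.\<close>
        have "l * (1 + 2 * y - f) * (f + \<delta> * f) \<le> 2 * c * (1 + \<delta>)"
          using key[of f y] f fy xy by (simp add: f_def)
        then have "(l * (1 + 2 * y - f) * f) * (1 + \<delta>) \<le> (2 * c) * (1 + \<delta>)"
          by (simp add: algebra_simps)
        then have "l * (1 + 2 * y - f) * f \<le> 2 * c"
          using \<delta> by (simp add: mult_le_cancel_right)
        then have "f * (l * (1 + 2 * y - f) * f) \<le> f * (2 * c)"
          using f by (intro mult_left_mono)
        then show ?thesis by (simp add: q_def power2_eq_square mult_ac)
      qed
      have qy: "l * q y \<le> 2 * (y - (1 - c) * f)"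
      proof -
        have y: "0 \<le> y" using xy by simp
        \<comment> \<open>The endpoint \<open>u = y\<close> corresponds to \<open>x = 0\<close>, an
          empty smaller slice; here \<open>2 / 5 \<le> c\<close> is what makes the bound
          hold.\<close>
        have "0 \<le> y * (1 - y) * ((c - 2 / 5) * (5 + 2 * y) / 3 + y / 10)"
          using y xy c by (intro mult_nonneg_nonneg add_nonneg_nonneg) auto
        also have "\<dots> = y - ((1 - c) * cubic y + q y / 2)"
          by (simp add: cubic_def q_def power2_eq_square field_simps)
        finally have "(1 - c) * cubic y + q y / 2 \<le> y" by simp
        then have "l * ((1 - c) * cubic y + q y / 2) \<le> l * y" using l by simp
        also have "\<dots> \<le> y" using l y by (simp add: mult_left_le_one_le)
        finally show ?thesis by (simp add: f_def algebra_simps)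
      qed
      have "(y - f) * (l * q u) = l * ((y - f) * q u)" by simp
      also have "\<dots> \<le> l * ((y - u) * q f + (u - f) * q y)"
        using conv l by (intro mult_left_mono) auto
      also have "\<dots> = (y - u) * (l * q f) + (u - f) * (l * q y)" by (simp add: algebra_simps)
      also have "\<dots> \<le> (y - u) * (2 * c * f) + (u - f) * (2 * (y - (1 - c) * f))"
        using qf qy u 3 by (intro add_mono mult_left_mono) auto
      also have "\<dots> = (y - f) * (2 * (u - (1 - c) * f))" by (simp add: algebra_simps)
      finally have "l * q u \<le> 2 * (u - (1 - c) * f)" using fy by simp
      then show ?thesis by (simp add: q_def mult_ac)
    qed
    ultimately show ?thesis
      unfolding mid f_def[symmetric] u_def[symmetric] using c
      by (intro exI[of _ 1] exI[of _ c]) (auto simp: algebra_simps)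
  qed
qed

section \<open>The hypothesis \<open>key\<close> for the exponents \<open>1 / 2\<close> and
  \<open>53 / 100\<close>\<close>

lemma cubic_tangent_bound_half:
  fixes u y :: real
  assumes "0 \<le> u" "u \<le> y" "y \<le> 1"
  shows "944 / 1000 * (1 + 2 * y - u) * (944 / 1000 * cubic y + 1 / 5 * u) \<le> 99 / 100"
proof -
  \<comment> \<open>\<open>319 / 500\<close> is close to the maximiser of
    \<open>f + 2 / 5 * y\<close>; \<open>cubic\<close> is expanded around it and the higher-order
    term dropped.\<close>
  define v where "v = y - 319 / 500"
  define f where "f = 944 / 1000 * cubic y"
  have v: "- (319 / 500) \<le> v" "v \<le> 181 / 500" using assms by (auto simp: v_def)
  have "f + 2 / 5 * y = 944 / 1000 * (1449479856 / 3000000000 - 1270264 / 3000000 * v -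
      v\<^sup>2 * (569 / 250 + 2 / 3 * v)) + 2 / 5 * (v + 319 / 500)"
    by (simp add: f_def cubic_def v_def power2_eq_square field_simps)
  also have "\<dots> \<le> 944 / 1000 * (1449479856 / 3000000000 - 1270264 / 3000000 * v) +
      2 / 5 * (v + 319 / 500)"
    using v by simp
  also have "\<dots> \<le> 715 / 1000" using v by (simp add: field_simps)
  finally have f: "f + 2 / 5 * y \<le> 715 / 1000" .
  have "0 \<le> f" using cubic_nonneg[of y] assms by (simp add: f_def)
  \<comment> \<open>After scaling by \<open>1 / 5\<close> the two factors have a sum independent of
    \<open>u\<close>, so the arithmetic-geometric mean inequality eliminates
    \<open>u\<close>.\<close>
  have "p * q \<le> (p + q)\<^sup>2 / 4" for p q :: real
    using zero_le_power2[of "p - q"] by (simp add: power2_eq_square field_simps)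
  from this[of "1 / 5 * (1 + 2 * y) - 1 / 5 * u" "f + 1 / 5 * u"]
  have "(1 / 5 * (1 + 2 * y) - 1 / 5 * u) * (f + 1 / 5 * u) \<le> (1 / 5 * (1 + 2 * y) + f)\<^sup>2 / 4"
    by simp
  also have "\<dots> \<le> (915 / 1000)\<^sup>2 / 4"
  proof (intro divide_right_mono power_mono)
    show "1 / 5 * (1 + 2 * y) + f \<le> 915 / 1000" using f by (simp add: distrib_left)
  qed (use \<open>0 \<le> f\<close> assms in auto)
  finally have le: "(1 / 5 * (1 + 2 * y) - 1 / 5 * u) * (f + 1 / 5 * u) \<le> (915 / 1000)\<^sup>2 / 4" .
  have "944 / 1000 * (1 + 2 * y - u) * (f + 1 / 5 * u) =
      944 / 200 * ((1 / 5 * (1 + 2 * y) - 1 / 5 * u) * (f + 1 / 5 * u))"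
    by (simp add: field_simps)
  also have "\<dots> \<le> 944 / 200 * ((915 / 1000)\<^sup>2 / 4)" by (rule mult_left_mono[OF le]) simp
  also have "\<dots> \<le> 99 / 100" by (simp add: power2_eq_square)
  finally show ?thesis unfolding f_def .
qed

text \<open>For \<open>y > 1 / 2\<close> the left side increases in \<open>u\<close> up to
  \<open>cubic y\<close>, so \<open>u = cubic y\<close> is the worst case. Then
  \<open>cubic y\<close> is replaced by an affine majorant, which leaves a quadratic in
  \<open>y\<close>. For \<open>y \<le> 1 / 2\<close> crude bounds suffice.\<close>

lemma cubic_tangent_bound_53:
  fixes u y :: real
  assumes u: "0 \<le> u" "u \<le> y" "y \<le> 1" "u \<le> cubic y"
  shows "(1 + 2 * y - u) * (cubic y + 1 / 2 * u) \<le> 132 / 100"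
proof (cases "y \<le> 1 / 2")
  case True
  have "0 \<le> (1 - 2 * y) * (3 - 4 * y - 2 * (y * y))"
    using True u mult_mono[of y "1 / 2" y "1 / 2"] by (intro mult_nonneg_nonneg) auto
  then have "cubic y \<le> 1 / 2" by (simp add: cubic_def field_simps)
  then have "(1 + 2 * y - u) * (cubic y + 1 / 2 * u) \<le> (2 - u) * (1 / 2 + 1 / 2 * u)"
    using True u cubic_nonneg[of y] by (intro mult_mono) auto
  also have "\<dots> \<le> 132 / 100"
    using zero_le_power2[of "u - 1 / 2"] by (simp add: power2_eq_square field_simps)
  finally show ?thesis .
next
  case False
  define f where "f = cubic y"
  define v where "v = y - 17 / 25"
  \<comment> \<open>The tangent of \<open>cubic\<close> at \<open>17 / 25\<close>, with coefficients
    rounded so that it stays above \<open>cubic\<close> on the range of \<open>v\<close>.\<close>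
  define T where "T = 4615 / 10000 - 618 / 1000 * v"
  have v: "- (18 / 100) \<le> v" "v \<le> 32 / 100" using False u by (auto simp: v_def)
  have "0 \<le> (2 * y - 1) * (4 * (y * y) + 8 * y - 3)"
    using False u by (intro mult_nonneg_nonneg) (auto simp: add_increasing)
  then have f2: "2 * f \<le> y + 1 / 2" by (simp add: f_def cubic_def field_simps)
  have "(1 + 2 * y - u) * (f + 1 / 2 * u) =
      (1 + 2 * y - f) * (3 / 2 * f) - (f - u) * ((1 + 2 * y) / 2 - f - (f + u) / 2)"
    by (simp add: field_simps)
  also have "\<dots> \<le> (1 + 2 * y - f) * (3 / 2 * f)"
    using u f2 by (simp add: f_def mult_nonneg_nonneg)
  also have "\<dots> \<le> 3 / 2 * ((1 + 2 * y - T) * T)"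
  proof -
    have "T - f = (4615 / 10000 - 28832 / 62500) + (1159 / 1875 - 618 / 1000) * v +
        v\<^sup>2 * (59 / 25 + 2 / 3 * v)"
      by (simp add: T_def f_def cubic_def v_def power2_eq_square field_simps)
    also have "\<dots> \<ge> 0"
    proof (rule add_nonneg_nonneg)
      show "0 \<le> v\<^sup>2 * (59 / 25 + 2 / 3 * v)" using v by (intro mult_nonneg_nonneg) auto
    qed (use v in simp)
    finally have "0 \<le> (T - f) * (1 + 2 * y - T - f)"
    proof (rule mult_nonneg_nonneg)
      have "y = v + 17 / 25" by (simp add: v_def)
      then show "0 \<le> 1 + 2 * y - T - f" unfolding T_def using v f2 by linarith
    qed
    then show ?thesis by (simp add: field_simps)
  qed
  also have "(1 + 2 * y - T) * T = 4615 * 18985 / 100000000 +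
      (2618 * 4615 / 10000000 - 618 * 18985 / 10000000) * v - 618 * 2618 / 1000000 * v\<^sup>2"
    by (simp add: T_def v_def power2_eq_square field_simps)
  also have "3 / 2 * \<dots> \<le> 132 / 100"
  proof -
    have "0 \<le> v\<^sup>2" by simp
    \<comment> \<open>The vertex of the quadratic is near \<open>v = 1 / 100\<close>.\<close>
    then show ?thesis using v zero_le_power2[of "v - 1 / 100"]
      by (simp add: power2_eq_square algebra_simps)
  qed
  finally show ?thesis by (simp add: f_def)
qed

section \<open>Rational estimates of real powers and the increment bounds
  \<open>incr\<close>\<close>

lemma powr_ge_of_power_le:
  fixes q \<beta> :: real and k m n :: nat
  assumes "q ^ n \<le> real k ^ m" "real m \<le> \<beta> * real n" "1 \<le> k" "0 < n"
  shows "q \<le> real k powr \<beta>"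
proof -
  obtain n' where n': "n = Suc n'" using assms(4) by (cases n) auto
  have "q ^ n \<le> real k powr real m" using assms by (simp add: powr_realpow)
  also have "\<dots> \<le> real k powr (\<beta> * real n)" using assms by (intro powr_mono) auto
  also have "\<dots> = (real k powr \<beta>) ^ n" using assms by (simp add: powr_power mult.commute)
  finally show ?thesis unfolding n' by (rule power_le_imp_le_base) simp
qed

lemma powr_le_of_power_le:
  fixes q \<beta> :: real and k m n :: nat
  assumes "real k ^ m \<le> q ^ n" "\<beta> * real n \<le> real m" "1 \<le> k" "0 < n" "0 \<le> q"
  shows "real k powr \<beta> \<le> q"
proof -
  obtain n' where n': "n = Suc n'" using assms(4) by (cases n) auto
  have "(real k powr \<beta>) ^ n = real k powr (\<beta> * real n)" using assms by (simp add: powr_power mult.commute)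
  also have "\<dots> \<le> real k powr real m" using assms by (intro powr_mono) auto
  also have "\<dots> \<le> q ^ n" using assms by (simp add: powr_realpow)
  finally show ?thesis unfolding n' using assms(5) by (rule power_le_imp_le_base)
qed

text \<open>Bernoulli's inequality for real exponents, from Young's inequality for
  \<open>s powr p\<close> and 1 with weights \<open>1 / p\<close> and
  \<open>1 - 1 / p\<close>.\<close>

lemma powr_ge_tangent:
  fixes s p :: real
  assumes "0 < s" "1 \<le> p"
  shows "1 + p * (s - 1) \<le> s powr p"
proof -
  have "(s powr p) powr (1 / p) * 1 powr (1 - 1 / p) \<le> 1 / p * s powr p + (1 - 1 / p) * 1"
    using assms by (intro Youngs_inequality_0) auto
  then have "s \<le> 1 / p * s powr p + (1 - 1 / p)"
    using assms by (simp add: powr_powr)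
  then have "p * s \<le> p * (1 / p * s powr p + (1 - 1 / p))"
    using assms by (intro mult_left_mono) auto
  then show ?thesis using assms by (simp add: algebra_simps)
qed

text \<open>Since \<open>0.53 = 1.06 / 2\<close>, the quadratic Taylor minorant of
  \<open>sqrt (1 + z)\<close> is combined with Bernoulli's inequality for the exponent
  \<open>1.06\<close>.\<close>

lemma powr_53_ge_quadratic:
  fixes z :: real
  assumes z: "0 \<le> z" "z \<le> 1"
  shows "1 + 53 / 100 * z * (1 - z / 4) \<le> (1 + z) powr (53 / 100)"
proof -
  have "(1 + z / 2 - z\<^sup>2 / 8)\<^sup>2 = 1 + z - z ^ 3 / 64 * (8 - z)"
    by (simp add: power2_eq_square power3_eq_cube field_simps)
  also have "\<dots> \<le> 1 + z" using z by simp
  finally have "1 + z / 2 - z\<^sup>2 / 8 \<le> sqrt (1 + z)" by (rule real_le_rsqrt)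
  then have "1 + 106 / 100 * (1 + z / 2 - z\<^sup>2 / 8 - 1) \<le> 1 + 106 / 100 * (sqrt (1 + z) - 1)"
    by simp
  then have "1 + 53 / 100 * z * (1 - z / 4) \<le> 1 + 106 / 100 * (sqrt (1 + z) - 1)"
    by (simp add: power2_eq_square right_diff_distrib)
  also have "\<dots> \<le> sqrt (1 + z) powr (106 / 100)" using z by (intro powr_ge_tangent) auto
  also have "\<dots> = (1 + z) powr (53 / 100)"
    using z by (simp add: powr_powr flip: powr_half_sqrt)
  finally show ?thesis .
qed

text \<open>The weights \<open>8 / 9\<close> and \<open>1 / 9\<close> in Young's inequality approximate the optimal \<open>47 / 53\<close> and
  \<open>6 / 53\<close> from above and below, leaving a small nonnegative exponent of \<open>k\<close>.\<close>

lemma powr_combination_ge: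
  fixes k :: real
  assumes "1 \<le> k"
  shows "1311 / 1000 \<le> k powr (6 / 100) + 1 / 2 * k powr (- (47 / 100))"
proof -
  let ?a = "9 / 8 * k powr (6 / 100)" and ?b = "9 / 2 * k powr (- (47 / 100))"
  let ?K = "k powr (6 / 100 * (8 / 9))" and ?L = "k powr (- (47 / 100) * (1 / 9))"
  let ?C = "(9 / 8) powr (8 / 9) * (9 / 2) powr (1 / 9) :: real"
  have "1311 / 1000 \<le> ?C"
  proof (rule power_le_imp_le_base)
    \<comment> \<open>The ninth power clears the fractional exponents and leaves a rational
      comparison.\<close>
    have "?C ^ Suc 8 = (9 / 8) ^ 8 * (9 / 2)"
      by (simp add: power_mult_distrib powr_power powr_numeral del: power_Suc)
    then show "(1311 / 1000) ^ Suc 8 \<le> ?C ^ Suc 8" by (simp add: power_divide)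
  qed simp
  also have "?C \<le> ?C * (?K * ?L)"
  proof -
    have "1 \<le> ?K * ?L" using assms by (simp add: ge_one_powr_ge_zero flip: powr_add)
    then have "?C * 1 \<le> ?C * (?K * ?L)" by (intro mult_left_mono) auto
    then show ?thesis by simp
  qed
  also have "\<dots> = ?a powr (8 / 9) * ?b powr (1 / 9)"
  proof -
    have "?a powr (8 / 9) = (9 / 8) powr (8 / 9) * ?K" "?b powr (1 / 9) = (9 / 2) powr (1 / 9) * ?L"
      by (simp_all only: powr_mult powr_powr)
    then show ?thesis by (simp only: mult_ac)
  qed
  also have "\<dots> \<le> 8 / 9 * ?a + 1 / 9 * ?b"
    using assms by (intro Youngs_inequality_0) auto
  also have "\<dots> = k powr (6 / 100) + 1 / 2 * k powr (- (47 / 100))" by simp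
  finally show ?thesis .
qed

text \<open>Allows a rational upper bound to replace \<open>k powr (53 / 100)\<close> in the
  increment bound.\<close>

lemma add_reciprocal_mono:
  fixes s t :: real
  assumes "1 \<le> s" "s \<le> t"
  shows "s + 66 / 100 / (s + 1 / 2) \<le> t + 66 / 100 / (t + 1 / 2)"
proof -
  have "3 / 2 * (3 / 2) \<le> (s + 1 / 2) * (t + 1 / 2)" using assms by (intro mult_mono) auto
  then have "0 \<le> (t - s) * (1 - 66 / 100 / ((s + 1 / 2) * (t + 1 / 2)))"
    using assms by (intro mult_nonneg_nonneg) auto
  also have "\<dots> = t + 66 / 100 / (t + 1 / 2) - (s + 66 / 100 / (s + 1 / 2))"
  proof -
    have "66 / 100 / p - 66 / 100 / q = (q - p) * (66 / 100 / (p * q))" if "0 < p" "0 < q" for p q :: real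
      using that by (simp add: field_simps)
    from this[of "s + 1 / 2" "t + 1 / 2"] assms
    have "66 / 100 / (s + 1 / 2) - 66 / 100 / (t + 1 / 2) =
        (t - s) * (66 / 100 / ((s + 1 / 2) * (t + 1 / 2)))"
      by simp
    then show ?thesis by (simp add: right_diff_distrib)
  qed
  finally show ?thesis by simp
qed

lemma powr_53_increment_ge:
  fixes k :: nat
  assumes "1 \<le> k"
  shows "real k powr (53 / 100) + 66 / 100 / (real k powr (53 / 100) + 1 / 2) \<le>
    real (k + 1) powr (53 / 100)"
proof -
  define t where "t = real k powr (53 / 100)"
  have t1: "1 \<le> t" using assms by (simp add: t_def ge_one_powr_ge_zero)
  \<comment> \<open>For \<open>k \<le> 4\<close> the powers are estimated through
    \<open>9 / 17 < 53 / 100 < 17 / 32\<close>. From \<open>k = 5\<close> on, the quadratic bound in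
    \<open>z = 1 / k\<close> is sharp enough.\<close>
  consider "k = 1" | "k = 2" | "k = 3" | "k = 4" | "5 \<le> k" using assms by linarith
  then have "t + 66 / 100 / (t + 1 / 2) \<le> real (k + 1) powr (53 / 100)"
  proof cases
    case 1
    show ?thesis
      using powr_ge_of_power_le[of "144 / 100" 17 2 9 "53 / 100"] by (simp add: t_def 1 power_divide)
  next
    case 2
    have "t \<le> 1446 / 1000"
      using powr_le_of_power_le[of 2 17 "1446 / 1000" 32 "53 / 100"] by (simp add: t_def 2 power_divide)
    from add_reciprocal_mono[OF t1 this] powr_ge_of_power_le[of "1788 / 1000" 17 3 9 "53 / 100"]
    show ?thesis by (simp add: 2 power_divide)
  next
    case 3
    have "t \<le> 1793 / 1000"
      using powr_le_of_power_le[of 3 17 "1793 / 1000" 32 "53 / 100"] by (simp add: t_def 3 power_divide)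
    from add_reciprocal_mono[OF t1 this] powr_ge_of_power_le[of "2082 / 1000" 17 4 9 "53 / 100"]
    show ?thesis by (simp add: 3 power_divide)
  next
    case 4
    have "t \<le> 2089 / 1000"
      using powr_le_of_power_le[of 4 17 "2089 / 1000" 32 "53 / 100"] by (simp add: t_def 4 power_divide)
    from add_reciprocal_mono[OF t1 this] powr_ge_of_power_le[of "2344 / 1000" 17 5 9 "53 / 100"]
    show ?thesis by (simp add: 4 power_divide)
  next
    case 5
    define z where "z = 1 / real k"
    have k: "0 < real k" and z: "0 < z" "z \<le> 1 / 5" using 5 by (auto simp: z_def field_simps)
    have split: "t * z * (t + 1 / 2) = k powr (6 / 100) + 1 / 2 * k powr (- (47 / 100))"
    proof -
      have "z = k powr (- 1)" using k by (simp add: z_def powr_minus_divide)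
      then have "t * z = k powr (53 / 100 + - 1)" unfolding t_def powr_add by simp
      then have tz: "t * z = k powr (- (47 / 100))" by simp
      have "k powr (- (47 / 100)) * t = k powr (6 / 100)" unfolding t_def by (simp flip: powr_add)
      then show ?thesis unfolding tz distrib_left by simp
    qed
    \<comment> \<open>\<open>5035 / 10000\<close> is \<open>53 / 100 * (1 - z / 4)\<close> at the
      extreme value \<open>z = 1 / 5\<close>.\<close>
    have "66 / 100 \<le> 5035 / 10000 * (t * z * (t + 1 / 2))"
      unfolding split using powr_combination_ge[of k] 5 by simp
    then have "66 / 100 / (t + 1 / 2) \<le> 5035 / 10000 * (t * z)"
      using t1 by (simp add: field_simps)
    also have "\<dots> \<le> 53 / 100 * (1 - z / 4) * (t * z)"
      using z t1 by (intro mult_right_mono) auto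
    finally have "t + 66 / 100 / (t + 1 / 2) \<le> t * (1 + 53 / 100 * z * (1 - z / 4))"
      by (simp add: algebra_simps)
    also have "\<dots> \<le> t * (1 + z) powr (53 / 100)"
      using z t1 by (intro mult_left_mono powr_53_ge_quadratic) auto
    also have "\<dots> = (real k * (1 + z)) powr (53 / 100)"
      using z k by (simp add: t_def powr_mult)
    also have "real k * (1 + z) = real (k + 1)" using k by (simp add: z_def distrib_left)
    finally show ?thesis .
  qed
  then show ?thesis by (simp add: t_def)
qed

text \<open>With \<open>t = sqrt k\<close>, squaring turns the claim into a polynomial inequality
  for \<open>t \<ge> 1\<close>.\<close>

lemma powr_half_increment_ge:
  fixes k :: nat
  assumes "1 \<le> k"
  shows "real k powr (1 / 2) + 495 / 1000 / (real k powr (1 / 2) + 1 / 5) \<le> real (k + 1) powr (1 / 2)"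
proof -
  define t where "t = sqrt (real k)"
  have t: "1 \<le> t" "t\<^sup>2 = real k" using assms by (auto simp: t_def)
  have "495 / 1000 * (495 / 1000) + 99 / 100 * t * (t + 1 / 5) \<le> (t + 1 / 5)\<^sup>2"
  proof -
    have "1 * 1 \<le> t * t" using t by (intro mult_mono) auto
    then show ?thesis using t(1) by (simp add: power2_eq_square field_simps)
  qed
  then have le: "t\<^sup>2 + (495 / 1000 * (495 / 1000) + 99 / 100 * t * (t + 1 / 5)) / (t + 1 / 5)\<^sup>2 \<le> t\<^sup>2 + 1"
    using t(1) by simp
  have r: "0 < t + 1 / 5" using t(1) by simp
  have sq: "(t + 495 / 1000 / r)\<^sup>2 =
      t\<^sup>2 + (495 / 1000 * (495 / 1000) + 99 / 100 * t * r) / r\<^sup>2" if "0 < r" for r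
    using that by (simp add: power2_eq_square field_simps)
  have "(t + 495 / 1000 / (t + 1 / 5))\<^sup>2 \<le> t\<^sup>2 + 1" unfolding sq[OF r] by (fact le)
  then have "t + 495 / 1000 / (t + 1 / 5) \<le> sqrt (t\<^sup>2 + 1)" by (rule real_le_rsqrt)
  then show ?thesis using t by (simp add: powr_half_sqrt t_def add.commute)
qed

text \<open>The left side increases with \<open>\<beta>\<close>, so its value at
  \<open>0.53\<close>, just below \<open>0.944\<close>, serves the whole range.\<close>

lemma sqrt_two_powr_le:
  fixes \<beta> :: real
  assumes "\<beta> \<le> 53 / 100"
  shows "sqrt (2 powr (\<beta> + 1) - 2) \<le> 944 / 1000"
proof (rule real_le_lsqrt)
  have "2 powr \<beta> \<le> 2 powr (53 / 100 :: real)" using assms by (intro powr_mono) auto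
  also have "\<dots> \<le> 14453 / 10000"
    using powr_le_of_power_le[of 2 17 "14453 / 10000" 32 "53 / 100"] by (simp add: power_divide)
  finally show "2 powr (\<beta> + 1) - 2 \<le> (944 / 1000)\<^sup>2"
    by (simp add: powr_add power2_eq_square)
qed simp

subsection \<open>The two exponents\<close>

lemma mean_w_ge_cubic:
  fixes c \<delta> l \<beta> :: real
  assumes l: "0 < l" "l \<le> 1" and \<delta>: "0 \<le> \<delta>" and c: "2 / 5 \<le> c" "c \<le> 1 / 2" and \<beta>: "0 \<le> \<beta>"
    and key: "\<And>u y. 0 \<le> u \<Longrightarrow> u \<le> y \<Longrightarrow> y \<le> 1 \<Longrightarrow> u \<le> l * cubic y \<Longrightarrow>
      l * (1 + 2 * y - u) * (l * cubic y + \<delta> * u) \<le> 2 * c * (1 + \<delta>)"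
    and incr: "\<And>k::nat. 1 \<le> k \<Longrightarrow>
      real k powr \<beta> + c * (1 + \<delta>) / (real k powr \<beta> + \<delta>) \<le> real (k + 1) powr \<beta>"
    and A: "A \<subseteq> cube n" "measure (\<mu> n) A = 1 / 2"
  shows "l \<le> mean_w \<beta> n A"
proof -
  have "2 * (l * cubic (1 / 2)) \<le> mean_w \<beta> n A"
    using \<beta> A
    by (intro mean_w_ge[where F = "\<lambda>y. l * cubic y"] bellman_two_point[OF l \<delta> c \<beta> key incr])
      (auto simp: cubic_def)
  then show ?thesis by (simp add: cubic_def)
qed

lemma mean_w_53_ge:
  assumes "A \<subseteq> cube n" "measure (\<mu> n) A = 1 / 2"
  shows "1 \<le> mean_w (53 / 100) n A"
\<comment> \<open>\<open>c\<close> lies just below \<open>2 powr (53 / 100) - 1\<close>, the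
  increment at \<open>k = 1\<close>; \<open>c * (1 + \<delta>)\<close> is
  \<open>66 / 100\<close>.\<close>
proof (rule mean_w_ge_cubic[where c = "44 / 100" and \<delta> = "1 / 2"])
  fix u y :: real
  assume "0 \<le> u" "u \<le> y" "y \<le> 1" "u \<le> 1 * cubic y"
  then show "1 * (1 + 2 * y - u) * (1 * cubic y + 1 / 2 * u) \<le> 2 * (44 / 100) * (1 + 1 / 2)"
    using cubic_tangent_bound_53[of u y] by simp
next
  fix k :: nat
  assume "1 \<le> k"
  then show "real k powr (53 / 100) + 44 / 100 * (1 + 1 / 2) / (real k powr (53 / 100) + 1 / 2) \<le>
      real (k + 1) powr (53 / 100)"
    using powr_53_increment_ge[of k] by simp
qed (use assms in auto)

lemma mean_w_half_ge:
  assumes "A \<subseteq> cube n" "measure (\<mu> n) A = 1 / 2"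
  shows "944 / 1000 \<le> mean_w (1 / 2) n A"
\<comment> \<open>Again \<open>c\<close> lies just below the increment \<open>sqrt 2 - 1\<close> at
  \<open>k = 1\<close>, and \<open>c * (1 + \<delta>)\<close> is \<open>495 / 1000\<close>.\<close>
proof (rule mean_w_ge_cubic[where c = "4125 / 10000" and \<delta> = "1 / 5"])
  fix u y :: real
  assume "0 \<le> u" "u \<le> y" "y \<le> 1"
  then show "944 / 1000 * (1 + 2 * y - u) * (944 / 1000 * cubic y + 1 / 5 * u) \<le>
      2 * (4125 / 10000) * (1 + 1 / 5)"
    using cubic_tangent_bound_half[of u y] by simp
next
  fix k :: nat
  assume "1 \<le> k"
  then show "real k powr (1 / 2) + 4125 / 10000 * (1 + 1 / 5) / (real k powr (1 / 2) + 1 / 5) \<le>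
      real (k + 1) powr (1 / 2)"
    using powr_half_increment_ge[of k] by simp
qed (use assms in auto)

lemma inf_boundary_53:
  assumes "53 / 100 \<le> \<beta>"
  shows "inf_boundary \<beta> = 1"
proof -
  have "1 \<le> mean_w \<beta> n A" if "A \<subseteq> cube n" "measure (\<mu> n) A = 1 / 2" for n A
    using mean_w_53_ge[OF that] mean_w_mono[OF that(1) assms] by linarith
  then show ?thesis using inf_boundary_ge[of 1 \<beta>] by (intro antisym) blast+
qed

lemma inf_boundary_half:
  assumes "1 / 2 \<le> \<beta>" "\<beta> < 53 / 100"
  shows "inf_boundary \<beta> \<le> 1" "sqrt (2 powr (\<beta> + 1) - 2) \<le> inf_boundary \<beta>"
proof -
  have "944 / 1000 \<le> mean_w \<beta> n A" if "A \<subseteq> cube n" "measure (\<mu> n) A = 1 / 2" for n A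
    using mean_w_half_ge[OF that] mean_w_mono[OF that(1) assms(1)] by linarith
  then have "944 / 1000 \<le> inf_boundary \<beta>" "inf_boundary \<beta> \<le> 1"
    using inf_boundary_ge[of "944 / 1000" \<beta>] by blast+
  then show "inf_boundary \<beta> \<le> 1" "sqrt (2 powr (\<beta> + 1) - 2) \<le> inf_boundary \<beta>"
    using sqrt_two_powr_le[of \<beta>] assms by linarith+
qed


theorem corollary1p7:
  shows "(\<forall>\<beta>::real. \<beta> \<ge> 0.53 \<longrightarrow> inf_boundary \<beta> = 1) \<and>
         (\<forall>\<beta>::real. 0.5 \<le> \<beta> \<and> \<beta> < 0.53 \<longrightarrow>
            1 \<ge> inf_boundary \<beta> \<and> inf_boundary \<beta> \<ge> sqrt (2 powr (\<beta> + 1) - 2))"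
  using inf_boundary_53 inf_boundary_half by auto

end
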